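(* Let $(X,\rho)$ be a metric space. If $X$ is unbounded, then $M_{\mathrm{loc}}(X)$ with the metric $H$ is not complete, i.e. there is a sequence in $M_{\mathrm{loc}}(X)$ which is Cauchy with respect to $H$ but has no limit with respect to $H$ in $M_{\mathrm{loc}}(X)$.
   Context: A measure on $X$ is a nonnegative countably additive set function on the Borel $\sigma$-algebra $\mathcal{B}(X)$ vanishing on $\varnothing$. The support of a measure $\mu$ is $\mathrm{spt}\,\mu=X\setminus\bigcup\{A\subset X: A\text{ is open and }\mu(A)=0\}$. $M_{\mathrm{loc}}(X)$ is the space of measures $\nu$ on $X$ with bounded support and $\nu(X)=1$, equipped with $H(\nu,\mu)=\sup\left|\int_X f\,d\nu-\int_X f\,d\mu\right|$, where the supremum is over all functions $f:X\to\mathbb{R}$ with $|f(x)-f(y)|\le\rho(x,y)$ for all $x,y\in X$. *)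

theory Defs
  imports "HOL-Analysis.Analysis"
begin

definition spt :: "'a::topological_space measure \<Rightarrow> 'a set" where
  "spt \<mu> = UNIV - \<Union>{A. open A \<and> emeasure \<mu> A = 0}"

definition M_loc :: "'a::metric_space measure set" where
  "M_loc = {\<nu>. sets \<nu> = sets borel \<and> bounded (spt \<nu>) \<and> emeasure \<nu> UNIV = 1}"

(* The supremum is taken in ennreal: a real-valued Sup of a set that is not bounded above would be
   an unspecified value. If each measure gives full mass to its support (automatic when the space
   is separable), every 1-Lipschitz function is integrable and the supremum is finite. In general
   the complement of the support need not be a null set; the Bochner integral of a non-integrable
   function is 0. *)
definition H_dist :: "'a::metric_space measure \<Rightarrow> 'a measure \<Rightarrow> ennreal" where
  "H_dist \<nu> \<mu> =
    (SUP f\<in>{f :: 'a \<Rightarrow> real. \<forall>x y. \<bar>f x - f y\<bar> \<le> dist x y}.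
      ennreal \<bar>(LINT x|\<nu>. f x) - (LINT x|\<mu>. f x)\<bar>)"

end

theory Submission
  imports Defs "HOL-Probability.Probability_Measure"
begin

text \<open>
  The obstruction to completeness is that a unit mass can send pieces of itself to infinity at
  finite total cost. Choose points \<open>x k\<close> that leave every bounded set, and weights
  \<open>c k > 0\<close> of sum 1 that decay so fast that the first moment \<open>\<Sum>k. c k * dist (x k) a\<close> is
  finite. Let \<open>s n\<close> carry mass \<open>c k\<close> at \<open>x k\<close> for \<open>k \<le> n\<close> and the remaining mass at \<open>a\<close>.
  Changing \<open>s m\<close> into \<open>s n\<close> only moves mass between \<open>a\<close> and points \<open>x k\<close> with
  \<open>k \<ge> min m n\<close>, so the distance is at most a tail of the first moment and the sequence is Cauchy.

  A limit \<open>\<nu>\<close> would have every \<open>x k\<close> in its support, which is then unbounded: if an open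
  \<open>\<nu>\<close>-null set contained the ball of radius \<open>r\<close> around \<open>x k\<close>, the 1-Lipschitz cone of height
  \<open>r\<close> over that ball would have integral 0 under \<open>\<nu>\<close> but at least \<open>c k * r\<close> under all \<open>s n\<close>
  with \<open>n \<ge> k\<close>. As the null set is taken around the point \<open>x k\<close> itself, this works on
  non-separable spaces too, where the complement of the support of \<open>\<nu>\<close> may have positive measure.

  All \<open>s n\<close> are images of one probability measure \<open>P\<close> on the naturals with masses \<open>c k\<close>, which
  turns the comparison of \<open>s m\<close> and \<open>s n\<close> into integrals over \<open>P\<close>
  (\<open>ex_full_nat_measure_integrable\<close>, \<open>H_dist_distr_le\<close>, \<open>in_spt_of_H_dist_limit\<close>).
\<close>

text \<open>The weights are \<open>(1/2) ^ k / (1 + d k)\<close>, normalised to total mass 1: the denominator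
  makes both the total mass and the integral of \<open>d\<close> dominated by a geometric series.\<close>

lemma ex_full_nat_measure_integrable:
  fixes d :: "nat \<Rightarrow> real"
  assumes d: "\<And>k. 0 \<le> d k"
  obtains P :: "nat measure"
  where "sets P = UNIV" "prob_space P" "\<And>k. 0 < measure P {k}" "integrable P d"
proof -
  define a where "a = (\<lambda>k. (1/2) ^ k / (1 + d k))"
  define c where "c = (\<lambda>k. a k / suminf a)"
  define P where "P = density (count_space UNIV) (\<lambda>k. ennreal (c k))"
  have a_pos: "0 < a k" for k
    using d[of k] by (simp add: a_def)
  have geom: "summable (\<lambda>k. (1/2::real) ^ k)"
    by (simp add: summable_geometric)
  have a_le: "a k \<le> (1/2) ^ k" for k
    using d[of k] by (simp add: a_def divide_simps)
  have ad_le: "a k * d k \<le> (1/2) ^ k" for k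
    using d[of k] by (simp add: a_def divide_simps)
  have sum_a: "summable a"
    by (rule summable_comparison_test'[OF geom, of 0])
       (use a_le a_pos in \<open>simp add: less_imp_le\<close>)
  have S_pos: "0 < suminf a"
    using suminf_pos[OF sum_a] a_pos by blast
  have c_pos: "0 < c k" for k
    using a_pos S_pos by (simp add: c_def)
  have "summable (\<lambda>k. a k * d k)"
    by (rule summable_comparison_test'[OF geom, of 0])
       (use ad_le a_pos d in \<open>simp add: less_imp_le\<close>)
  then have "summable (\<lambda>k. a k * d k / suminf a)"
    by (rule summable_divide)
  then have sum_cd: "summable (\<lambda>k. c k * d k)"
    by (simp add: c_def)
  have "suminf c = 1" "summable c"
    using suminf_divide[OF sum_a, of "suminf a"] summable_divide[OF sum_a, of "suminf a"] S_pos
    by (simp_all add: c_def)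
  then have "(\<Sum>k. ennreal (c k)) = 1"
    using c_pos by (subst suminf_ennreal2) (auto intro: less_imp_le)
  then have mass: "emeasure P (space P) = 1"
    by (simp add: P_def emeasure_density nn_integral_count_space_nat)
  have "emeasure P {k} = (\<integral>\<^sup>+ j. ennreal (c k) * indicator {k} j \<partial>count_space UNIV)" for k
    unfolding P_def by (subst emeasure_density) (auto intro!: nn_integral_cong simp: indicator_def)
  then have "emeasure P {k} = ennreal (c k)" for k
    by (simp add: nn_integral_cmult_indicator)
  then have "0 < measure P {k}" for k
    using c_pos[of k] by (simp add: measure_def)
  moreover have "integrable P d"
    unfolding P_def using sum_cd c_pos d
    by (subst integrable_density) (auto simp: integrable_count_space_nat_iff less_imp_le)
  moreover have "sets P = UNIV"
    by (simp add: P_def)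
  ultimately show thesis
    using that prob_spaceI[OF mass] by blast
qed

lemma H_dist_distr_le:
  fixes f g :: "nat \<Rightarrow> 'a::metric_space" and P :: "nat measure"
  assumes P: "sets P = UNIV" "prob_space P"
    and fin: "finite (range f)" "finite (range g)"
    and h: "integrable P h" "\<And>k. dist (f k) (g k) \<le> h k"
  shows "H_dist (distr P borel f) (distr P borel g) \<le> ennreal (integral\<^sup>L P h)"
  unfolding H_dist_def
proof (rule SUP_least, rule ennreal_leI)
  interpret prob_space P by fact
  fix u :: "'a \<Rightarrow> real"
  assume u: "u \<in> {f. \<forall>x y. \<bar>f x - f y\<bar> \<le> dist x y}"
  then have "1-lipschitz_on UNIV u"
    by (auto simp: lipschitz_on_def dist_real_def)
  then have [measurable]: "u \<in> borel_measurable borel"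
    by (intro borel_measurable_continuous_onI lipschitz_on_continuous_on)
  have any_meas: "v \<in> measurable P M" if "\<And>k. v k \<in> space M" for v and M :: "'c measure"
    using P(1) that sets_eq_imp_space_eq[of P "count_space UNIV"] by (auto simp: measurable_def)
  have [measurable]: "f \<in> measurable P borel" "g \<in> measurable P borel"
    by (auto intro: any_meas)
  have int: "integrable P (\<lambda>k. u (v k))" if "finite (range v)" for v :: "nat \<Rightarrow> 'a"
  proof (rule integrable_const_bound)
    have "finite (range (\<lambda>k. norm (u (v k))))"
      using finite_imageI[OF that, of "\<lambda>x. norm (u x)"] by (simp add: image_image)
    then show "AE k in P. norm (u (v k)) \<le> Max (range (\<lambda>k. norm (u (v k))))"
      by (intro AE_I2 Max_ge) auto
  qed (auto intro: any_meas)
  have "\<bar>(LINT x|distr P borel f. u x) - (LINT x|distr P borel g. u x)\<bar>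
      = \<bar>LINT k|P. u (f k) - u (g k)\<bar>"
    using int fin by (simp add: integral_distr)
  also have "\<dots> \<le> (LINT k|P. \<bar>u (f k) - u (g k)\<bar>)"
    by (rule integral_abs_bound)
  also have "\<dots> \<le> integral\<^sup>L P h"
    using u h int fin by (intro integral_mono) (auto intro: order_trans)
  finally show "\<bar>(LINT x|distr P borel f. u x) - (LINT x|distr P borel g. u x)\<bar> \<le> integral\<^sup>L P h" .
qed

text \<open>An atom of mass \<open>c\<close> at \<open>x\<close> gives the cone \<open>\<lambda>y. max 0 (r - dist y x)\<close> an integral of at
  least \<open>c * r\<close>. The cone is bounded, hence integrable for every finite measure, and it vanishes
  off the ball, so its integral is 0 if the ball is null.\<close>

lemma in_spt_of_H_dist_limit:
  fixes x :: "'a::metric_space"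
  assumes "0 < c"
    and s: "\<forall>\<^sub>F n in sequentially. sets (s n) = sets borel \<and> finite_measure (s n) \<and> c \<le> measure (s n) {x}"
    and \<nu>: "sets \<nu> = sets borel"
    and lim: "(\<lambda>n. H_dist (s n) \<nu>) \<longlonglongrightarrow> 0"
  shows "x \<in> spt \<nu>"
proof (rule ccontr)
  assume "x \<notin> spt \<nu>"
  then obtain A where A: "open A" "emeasure \<nu> A = 0" "x \<in> A"
    by (auto simp: spt_def)
  then obtain r where r: "0 < r" "ball x r \<subseteq> A"
    by (meson openE)
  define f where "f = (\<lambda>y. max 0 (r - dist y x))"
  have f_meas: "f \<in> borel_measurable borel"
    unfolding f_def by (intro borel_measurable_continuous_onI continuous_intros)
  have "\<bar>f y - f z\<bar> \<le> dist y z" for y z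
    using dist_triangle[of y x z] dist_triangle[of z x y] by (auto simp: f_def dist_commute max_def)
  then have lip: "f \<in> {f. \<forall>y z. \<bar>f y - f z\<bar> \<le> dist y z}"
    by blast
  have "A \<in> null_sets \<nu>"
    using A \<nu> by (auto simp: null_sets_def)
  then have "AE y in \<nu>. f y = 0"
    by (rule AE_I') (use r in \<open>auto simp: f_def dist_commute subset_eq max_def\<close>)
  then have f_\<nu>: "integral\<^sup>L \<nu> f = 0"
    by (rule integral_eq_zero_AE)
  have "\<forall>\<^sub>F n in sequentially. ennreal (c * r) \<le> H_dist (s n) \<nu>"
    using s
  proof eventually_elim
    case (elim n)
    then interpret finite_measure "s n" by blast
    have f_meas': "f \<in> borel_measurable (s n)"
      using f_meas elim measurable_cong_sets[of "s n" borel] by blast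
    have "c * r \<le> measure (s n) {x} * r"
      using elim r by (intro mult_right_mono) auto
    also have "\<dots> = (LINT y|s n. indicator {x} y * r)"
      using elim sets_eq_imp_space_eq[of "s n" borel] by simp
    also have "\<dots> \<le> integral\<^sup>L (s n) f"
    proof (rule integral_mono)
      show "integrable (s n) (\<lambda>y. indicator {x} y * r)"
        using elim by (intro integrable_mult_left integrable_real_indicator) (auto simp: less_top[symmetric])
      show "integrable (s n) f"
        using f_meas' r by (intro integrable_const_bound[of _ r]) (auto simp: f_def)
      show "indicator {x} y * r \<le> f y" for y
        by (auto simp: f_def indicator_def)
    qed
    finally have "ennreal (c * r) \<le> ennreal \<bar>integral\<^sup>L (s n) f - integral\<^sup>L \<nu> f\<bar>"
      using f_\<nu> by (intro ennreal_leI) simp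
    also have "\<dots> \<le> H_dist (s n) \<nu>"
      unfolding H_dist_def by (rule SUP_upper[OF lip])
    finally show ?case .
  qed
  then have "ennreal (c * r) \<le> 0"
    by (intro tendsto_lowerbound[OF lim]) auto
  then show False
    using \<open>0 < c\<close> r by (simp add: ennreal_eq_0_iff mult_le_0_iff)
qed

theorem mainTheorem3:
  assumes "\<not> bounded (UNIV :: 'a::metric_space set)"
  shows "\<exists>s :: nat \<Rightarrow> 'a measure.
    (\<forall>n. s n \<in> M_loc) \<and>
    (\<forall>\<epsilon>::real. \<epsilon> > 0 \<longrightarrow> (\<exists>N. \<forall>m\<ge>N. \<forall>n\<ge>N. H_dist (s m) (s n) < ennreal \<epsilon>)) \<and>
    \<not> (\<exists>\<nu>\<in>M_loc. (\<lambda>n. H_dist (s n) \<nu>) \<longlonglongrightarrow> 0)"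
proof -
  obtain a :: 'a where True by simp
  have "\<exists>z. real k < dist a z" for k
    using assms by (meson bounded_def UNIV_I not_le)
  then obtain x where x: "\<And>k. real k < dist a (x k)"
    by metis
  obtain P where P: "sets P = UNIV" "prob_space P" "\<And>k. 0 < measure P {k}"
    and int_d: "integrable P (\<lambda>k. dist a (x k))"
    using ex_full_nat_measure_integrable[of "\<lambda>k. dist a (x k)"] by auto
  interpret prob_space P by fact
  have space_P: "space P = UNIV"
    using P(1) sets_eq_imp_space_eq[of P "count_space UNIV"] by simp
  define y where "y = (\<lambda>n k. if k \<le> n then x k else a)"
  define s where "s = (\<lambda>n. distr P borel (y n))"
  have y_meas: "y n \<in> measurable P borel" for n
    using P(1) by (auto simp: measurable_def)
  have em_s: "emeasure (s n) B = emeasure P (y n -` B)" if "B \<in> sets borel" for n B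
    using that y_meas by (simp add: s_def emeasure_distr space_P)
  have "range (y n) \<subseteq> insert a (x ` {..n})" for n
    by (auto simp: y_def)
  then have fin: "finite (range (y n))" for n
    by (rule finite_subset) simp

  have "s n \<in> M_loc" for n
  proof -
    have "y n -` (- range (y n)) = {}"
      by auto
    then have "emeasure (s n) (- range (y n)) = 0" "open (- range (y n))"
      using em_s[of "- range (y n)" n] finite_imp_closed[OF fin] by auto
    then have "spt (s n) \<subseteq> range (y n)"
      unfolding spt_def by blast
    then have "bounded (spt (s n))"
      using finite_imp_bounded[OF fin] bounded_subset by blast
    moreover have "emeasure (s n) UNIV = 1"
      using em_s[of UNIV n] emeasure_space_1 space_P by simp
    ultimately show ?thesis
      by (simp add: M_loc_def s_def)
  qed
  moreover have "\<exists>N. \<forall>m\<ge>N. \<forall>n\<ge>N. H_dist (s m) (s n) < ennreal \<epsilon>" if "0 < \<epsilon>" for \<epsilon> :: real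
  proof -
    define h where "h = (\<lambda>N k. indicator {N..} k * dist a (x k))"
    have meas: "v \<in> borel_measurable P" for v :: "nat \<Rightarrow> real"
      using P(1) by (auto simp: measurable_def)
    have int_h: "integrable P (h N)" for N
      by (rule Bochner_Integration.integrable_bound[OF int_d])
         (auto simp: h_def indicator_def intro: meas)
    have "(\<lambda>N. h N k) \<longlonglongrightarrow> 0" for k
      by (rule tendsto_eventually, rule eventually_sequentiallyI[of "Suc k"]) (simp add: h_def)
    then have "(\<lambda>N. integral\<^sup>L P (h N)) \<longlonglongrightarrow> integral\<^sup>L P (\<lambda>k. 0)"
      by (intro integral_dominated_convergence[OF meas meas int_d])
         (auto simp: h_def indicator_def)
    then have "\<forall>\<^sub>F N in sequentially. integral\<^sup>L P (h N) < \<epsilon>"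
      using \<open>0 < \<epsilon>\<close> order_tendstoD(2) by fastforce
    then obtain N where N: "integral\<^sup>L P (h N) < \<epsilon>"
      by (auto simp: eventually_sequentially)
    have "H_dist (s m) (s n) < ennreal \<epsilon>" if "m \<ge> N" "n \<ge> N" for m n
    proof -
      have "dist (y m k) (y n k) \<le> h N k" for k
        using that by (auto simp: y_def h_def indicator_def dist_commute)
      then have "H_dist (s m) (s n) \<le> ennreal (integral\<^sup>L P (h N))"
        unfolding s_def by (intro H_dist_distr_le P fin int_h)
      also have "\<dots> < ennreal \<epsilon>"
        using N \<open>0 < \<epsilon>\<close> by (rule ennreal_lessI[rotated])
      finally show ?thesis .
    qed
    then show ?thesis by blast
  qed
  moreover have False if \<nu>: "\<nu> \<in> M_loc" "(\<lambda>n. H_dist (s n) \<nu>) \<longlonglongrightarrow> 0" for \<nu>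
  proof -
    have "x k \<in> spt \<nu>" for k
    proof (rule in_spt_of_H_dist_limit[OF P(3)[of k] _ _ \<nu>(2)])
      have "measure P {k} \<le> measure (s n) {x k}" if "n \<ge> k" for n
        unfolding measure_def using that P(1) em_s[of "{x k}" n]
        by (auto simp: y_def intro!: enn2real_mono emeasure_mono simp: less_top[symmetric])
      moreover have "finite_measure (s n)" for n
        unfolding s_def using y_meas by (rule finite_measure_distr)
      ultimately show "\<forall>\<^sub>F n in sequentially. sets (s n) = sets borel \<and> finite_measure (s n) \<and>
          measure P {k} \<le> measure (s n) {x k}"
        by (intro eventually_sequentiallyI[of k]) (simp add: s_def)
      show "sets \<nu> = sets borel"
        using \<nu>(1) by (simp add: M_loc_def)
    qed
    moreover have "bounded (spt \<nu>)"
      using \<nu>(1) by (simp add: M_loc_def)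
    ultimately obtain e where "\<And>k. dist a (x k) \<le> e"
      using bounded_any_center[of "spt \<nu>" a] by auto
    moreover obtain k where "e < real k"
      using reals_Archimedean2 by blast
    ultimately show False
      using x[of k] by (meson less_le_not_le order_trans)
  qed
  ultimately show ?thesis
    by blast
qed

end
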